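(* Let $(R,\mathfrak m)$ be a local Artinian ring, let $\mathbf s=(0:\mathfrak m)$ denote the socle of $R$, and let $s$ be the dimension of $\mathbf s$ as a vector space over $R/\mathfrak m$. Suppose $g(t)\in R[t]$ is a polynomial of degree $n$ and let $I=(0:_R c(g))$. Let $J$ be any ideal of $R$ such that $I\subseteq J\subseteq (I:\mathfrak m)$ and $r:=\dim_{R/\mathfrak m}(J/I)>s$, and let $m$ be any nonnegative integer such that $(m+1)r>(n+m+1)s$. Then there exists a polynomial $f(t)\in R[t]$ of degree $m$ such that (a) $c(f)\subseteq J$; (b) $fg=0$; (c) $c(f)c(g)\neq 0$.
   Context: Rings are commutative with identity and $t$ is an indeterminate. For $f\in R[t]$, the content ideal $c(f)$ is the ideal of $R$ generated by the coefficients of $f$. For ideals $I,K$ of $R$, $(I:K)=\{x\in R: xK\subseteq I\}$. *)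

theory Defs
  imports
    "HOL-Algebra.UnivPoly"
    "HOL-Algebra.QuotRing"
    "HOL-Algebra.Ideal_Product"
    "Jordan_Normal_Form.Missing_VectorSpace"
begin

locale artinian_ring = ring +
  assumes descending_chain_condition:
    "\<lbrakk>\<And>k :: nat. ideal (C k) R; \<And>k. C (Suc k) \<subseteq> C k\<rbrakk> \<Longrightarrow> \<exists>N. \<forall>k\<ge>N. C k = C N"

locale local_ring = cring R + maximalideal \<mm> R for \<mm> and R (structure) +
  assumes unique_maximal: "maximalideal M R \<Longrightarrow> M = \<mm>"

definition colon :: "('a, 'b) ring_scheme \<Rightarrow> 'a set \<Rightarrow> 'a set \<Rightarrow> 'a set"
  where "colon R I K = {x \<in> carrier R. \<forall>k\<in>K. x \<otimes>\<^bsub>R\<^esub> k \<in> I}"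

definition content :: "('a, 'b) ring_scheme \<Rightarrow> (nat \<Rightarrow> 'a) \<Rightarrow> 'a set"
  where "content R f = Idl\<^bsub>R\<^esub> (range (coeff (UP R) f))"

text \<open>
  An ideal \<open>V\<close> with \<open>\<mm> V = 0\<close>, as a module over \<open>R Quot \<mm>\<close>: the coset \<open>\<mm> + a\<close> acts
  on \<open>x\<close> as \<open>a x\<close>, the only element of \<open>{b x | b \<in> \<mm> + a}\<close>.  In this definition and the
  next one the fields \<open>mult\<close> and \<open>one\<close> belong to the record type but play no role in a module.
\<close>

definition residue_module :: "('a, 'b) ring_scheme \<Rightarrow> 'a set \<Rightarrow> ('a set, 'a) module"
  where "residue_module R V =
    \<lparr>carrier = V, mult = mult R, one = one R, zero = zero R, add = add R,
     smult = (\<lambda>A x. the_elem ((\<lambda>a. a \<otimes>\<^bsub>R\<^esub> x) ` A))\<rparr>"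

text \<open>
  The quotient \<open>J / I\<close> of ideals \<open>I \<subseteq> J\<close> with \<open>\<mm> J \<subseteq> I\<close>, as a module over \<open>R Quot \<mm>\<close>.
  Here \<open>rcoset_mult R I A B\<close> is the union of the cosets \<open>I + a b\<close> with \<open>a \<in> A\<close> and
  \<open>b \<in> B\<close>; for \<open>A = \<mm> + a\<close> and \<open>B = I + x\<close> with \<open>x \<in> J\<close> they all coincide with
  \<open>I + a x\<close>.
\<close>

definition quotient_module :: "('a, 'b) ring_scheme \<Rightarrow> 'a set \<Rightarrow> 'a set \<Rightarrow> ('a set, 'a set) module"
  where "quotient_module R J I =
    \<lparr>carrier = (\<lambda>x. I +>\<^bsub>R\<^esub> x) ` J, mult = rcoset_mult R I, one = I +>\<^bsub>R\<^esub> \<one>\<^bsub>R\<^esub>,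
     zero = I, add = set_add R, smult = rcoset_mult R I\<rparr>"

lemma (in ring) in_coset_decomp:
  assumes "ideal I R" "a \<in> carrier R" "b \<in> I +> a"
  obtains i where "i \<in> I" "b = i \<oplus> a"
  using assms(3) unfolding a_r_coset_def' by blast

lemma (in cring) residue_smult:
  assumes m: "ideal \<mm> R" and V: "V \<subseteq> colon R {\<zero>} \<mm>" and a: "a \<in> carrier R" and x: "x \<in> V"
  shows "(\<mm> +> a) \<odot>\<^bsub>residue_module R V\<^esub> x = a \<otimes> x"
proof -
  interpret m: ideal \<mm> R by fact
  have xc: "x \<in> carrier R" and ann: "\<And>k. k \<in> \<mm> \<Longrightarrow> k \<otimes> x = \<zero>"
    using V x m.Icarr by (auto simp: colon_def m_comm)
  have "(\<lambda>b. b \<otimes> x) ` (\<mm> +> a) = {a \<otimes> x}"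
  proof -
    have "b \<otimes> x = a \<otimes> x" if "b \<in> \<mm> +> a" for b
      using in_coset_decomp[OF m a that] ann xc a m.Icarr by (metis l_distr l_zero m_closed)
    moreover have "a \<in> \<mm> +> a" using m.a_rcos_self a by simp
    ultimately show ?thesis by blast
  qed
  then show ?thesis by (simp add: residue_module_def)
qed

lemma (in cring) quotient_smult:
  assumes m: "ideal \<mm> R" and I: "ideal I R" and J: "J \<subseteq> colon R I \<mm>"
    and a: "a \<in> carrier R" and x: "x \<in> J"
  shows "(\<mm> +> a) \<odot>\<^bsub>quotient_module R J I\<^esub> (I +> x) = I +> (a \<otimes> x)"
proof -
  interpret m: ideal \<mm> R by fact
  interpret I: ideal I R by fact
  have xc: "x \<in> carrier R" and ann: "\<And>k. k \<in> \<mm> \<Longrightarrow> k \<otimes> x \<in> I"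
    using J x m.Icarr by (auto simp: colon_def m_comm)
  have eq: "I +> (b \<otimes> y) = I +> (a \<otimes> x)" if b: "b \<in> \<mm> +> a" and y: "y \<in> I +> x" for b y
  proof -
    obtain k where k: "k \<in> \<mm>" "b = k \<oplus> a" using in_coset_decomp[OF m a b] .
    obtain i where i: "i \<in> I" "y = i \<oplus> x" using in_coset_decomp[OF I xc y] .
    have kc: "k \<in> carrier R" and ic: "i \<in> carrier R" using k i m.Icarr I.Icarr by auto
    have "b \<otimes> y = (b \<otimes> i \<oplus> k \<otimes> x) \<oplus> a \<otimes> x"
      using k i kc ic a xc by (simp add: l_distr r_distr a_ac)
    moreover have "b \<otimes> i \<oplus> k \<otimes> x \<in> I"
      using k(2) i(1) ann[OF k(1)] kc a by (simp add: I.I_l_closed I.a_closed)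
    ultimately have "b \<otimes> y \<in> I +> (a \<otimes> x)" unfolding a_r_coset_def' by blast
    then show ?thesis
      using a_repr_independence[OF _ m_closed[OF a xc] I.a_subgroup] by simp
  qed
  have "a \<in> \<mm> +> a" "x \<in> I +> x" using m.a_rcos_self I.a_rcos_self a xc by simp_all
  with eq have "(\<Union>b\<in>\<mm> +> a. \<Union>y\<in>I +> x. I +> (b \<otimes> y)) = I +> (a \<otimes> x)" by blast
  then show ?thesis by (simp add: quotient_module_def rcoset_mult_def)
qed

lemma (in cring) colon_ideal:
  assumes I: "ideal I R" and K: "K \<subseteq> carrier R"
  shows "ideal (colon R I K) R"
proof -
  interpret I: ideal I R by fact
  have Kc: "\<And>k. k \<in> K \<Longrightarrow> k \<in> carrier R" using K by auto
  show ?thesis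
  proof (rule idealI)
    show "ring R" by (rule ring_axioms)
    show "subgroup (colon R I K) (add_monoid R)"
    proof (rule add.subgroupI)
      show "colon R I K \<noteq> {}"
        using Kc I.zero_closed by (auto simp: colon_def intro!: exI[of _ \<zero>])
    next
      fix x assume "x \<in> colon R I K"
      then show "\<ominus> x \<in> colon R I K"
        using Kc by (auto simp: colon_def l_minus I.a_inv_closed)
    qed (use Kc in \<open>auto simp: colon_def l_distr I.a_closed\<close>)
  next
    fix a x
    assume a: "a \<in> colon R I K" and x: "x \<in> carrier R"
    then have ac: "a \<in> carrier R" and ak: "\<And>k. k \<in> K \<Longrightarrow> a \<otimes> k \<in> I"
      by (auto simp: colon_def)
    have "(x \<otimes> a) \<otimes> k \<in> I" if "k \<in> K" for k
      using I.I_l_closed[OF ak[OF that] x] ac x Kc[OF that] by (simp add: m_assoc)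
    with ac x show xa: "x \<otimes> a \<in> colon R I K" by (simp add: colon_def)
    with ac x show "a \<otimes> x \<in> colon R I K" by (simp add: m_comm)
  qed
qed

lemma (in local_ring) residue_module_vectorspace:
  assumes V: "ideal V R" "V \<subseteq> colon R {\<zero>} \<mm>"
  shows "vectorspace (R Quot \<mm>) (residue_module R V)"
proof -
  interpret V: ideal V R by fact
  have field: "field (R Quot \<mm>)" by (rule quotient_is_field) (rule is_cring)
  interpret Q: field "R Quot \<mm>" by (rule field)
  have carr: "A \<in> carrier (R Quot \<mm>) \<longleftrightarrow> (\<exists>a\<in>carrier R. A = \<mm> +> a)" for A
    by (auto simp: FactRing_def A_RCOSETS_def' a_r_coset_def')
  have act: "(\<mm> +> a) \<odot>\<^bsub>residue_module R V\<^esub> x = a \<otimes> x"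
    if "a \<in> carrier R" "x \<in> V" for a x
    using residue_smult[OF is_ideal V(2) that] .
  have sums: "(\<mm> +> a) \<oplus>\<^bsub>R Quot \<mm>\<^esub> (\<mm> +> b) = \<mm> +> (a \<oplus> b)"
    and prods: "(\<mm> +> a) \<otimes>\<^bsub>R Quot \<mm>\<^esub> (\<mm> +> b) = \<mm> +> (a \<otimes> b)"
    if "a \<in> carrier R" "b \<in> carrier R" for a b
    using that by (simp_all add: FactRing_def a_rcos_sum rcoset_mult_add)
  have simps: "carrier (residue_module R V) = V" "add (residue_module R V) = add R"
    "zero (residue_module R V) = \<zero>" "one (R Quot \<mm>) = \<mm> +> \<one>"
    by (simp_all add: residue_module_def FactRing_def)
  have "abelian_group (residue_module R V)"
  proof (rule abelian_groupI, unfold simps)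
    fix x assume "x \<in> V"
    then show "\<exists>y\<in>V. y \<oplus> x = \<zero>"
      by (intro bexI[of _ "\<ominus> x"]) (auto simp: V.Icarr l_neg V.a_inv_closed)
  qed (auto simp: V.Icarr V.a_closed a_ac)
  then have "module (R Quot \<mm>) (residue_module R V)"
    by (intro moduleI Q.is_cring)
      (auto simp: simps carr act sums prods V.Icarr V.a_closed V.I_l_closed l_distr r_distr m_assoc)
  with field show ?thesis by (simp add: vectorspace_def)
qed

lemma (in local_ring) quotient_module_vectorspace:
  assumes I: "ideal I R" and J: "ideal J R" "J \<subseteq> colon R I \<mm>"
  shows "vectorspace (R Quot \<mm>) (quotient_module R J I)"
proof -
  interpret I: ideal I R by fact
  interpret J: ideal J R by fact
  have field: "field (R Quot \<mm>)" by (rule quotient_is_field) (rule is_cring)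
  interpret Q: field "R Quot \<mm>" by (rule field)
  have carr: "A \<in> carrier (R Quot \<mm>) \<longleftrightarrow> (\<exists>a\<in>carrier R. A = \<mm> +> a)" for A
    by (auto simp: FactRing_def A_RCOSETS_def' a_r_coset_def')
  have act: "(\<mm> +> a) \<odot>\<^bsub>quotient_module R J I\<^esub> (I +> x) = I +> (a \<otimes> x)"
    if "a \<in> carrier R" "x \<in> J" for a x
    using quotient_smult[OF is_ideal I J(2) that] .
  have sums: "(\<mm> +> a) \<oplus>\<^bsub>R Quot \<mm>\<^esub> (\<mm> +> b) = \<mm> +> (a \<oplus> b)"
    and prods: "(\<mm> +> a) \<otimes>\<^bsub>R Quot \<mm>\<^esub> (\<mm> +> b) = \<mm> +> (a \<otimes> b)"
    if "a \<in> carrier R" "b \<in> carrier R" for a b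
    using that by (simp_all add: FactRing_def a_rcos_sum rcoset_mult_add)
  have zero: "I = I +> \<zero>" using a_rcos_zero[OF I] I.zero_closed by simp
  have simps: "carrier (quotient_module R J I) = (\<lambda>x. I +> x) ` J"
    "zero (quotient_module R J I) = I +> \<zero>" "one (R Quot \<mm>) = \<mm> +> \<one>"
    using zero by (simp_all add: quotient_module_def FactRing_def)
  have add: "(I +> x) \<oplus>\<^bsub>quotient_module R J I\<^esub> (I +> y) = I +> (x \<oplus> y)"
    if "x \<in> J" "y \<in> J" for x y
    using that by (simp add: quotient_module_def I.a_rcos_sum J.Icarr)
  have "abelian_group (quotient_module R J I)"
  proof (rule abelian_groupI, unfold simps)
    fix A assume "A \<in> (\<lambda>x. I +> x) ` J"
    then obtain x where x: "x \<in> J" "A = I +> x" by auto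
    then show "\<exists>B\<in>(\<lambda>x. I +> x) ` J. B \<oplus>\<^bsub>quotient_module R J I\<^esub> A = I +> \<zero>"
      by (intro bexI[of _ "I +> \<ominus> x"]) (auto simp: add J.Icarr l_neg J.a_inv_closed)
  qed (auto simp: add J.Icarr J.a_closed J.zero_closed a_ac)
  then have "module (R Quot \<mm>) (quotient_module R J I)"
    by (intro moduleI Q.is_cring)
      (auto simp: simps carr act add sums prods J.Icarr J.a_closed J.I_l_closed
        l_distr r_distr m_assoc)
  with field show ?thesis by (simp add: vectorspace_def)
qed

end

theory Submission
  imports Defs
begin

text \<open>
  Since \<open>\<mm> J \<subseteq> I\<close> and \<open>I c(g) = 0\<close>, the product of an element of \<open>J\<close> with a coefficient of
  \<open>g\<close> lies in the socle.  Multiplication by \<open>g\<close> therefore induces a linear map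
  \<open>(J / I)\<^sup>m\<^sup>+\<^sup>1 \<rightarrow> (0 : \<mm>)\<^sup>n\<^sup>+\<^sup>m\<^sup>+\<^sup>1\<close> from a space of dimension \<open>(m + 1) r\<close> to one of dimension
  \<open>(n + m + 1) s\<close>, the latter being finite by the descending chain condition.  A nonzero element
  of its kernel is a polynomial over \<open>J\<close> that annihilates \<open>g\<close> and has a coefficient outside
  \<open>I = (0 : c(g))\<close>.
\<close>

section \<open>Homogeneous linear systems over a field\<close>

text \<open>Gaussian elimination, one equation at a time. The induction ranges over all
  \<open>U\<close> and \<open>a\<close> because eliminating a pivot removes an unknown and changes
  the coefficients.\<close>

lemma (in field) homogeneous_system_nontrivial_solution:
  assumes "finite E" "finite U" "card E < card U"
    and "\<And>e u. e \<in> E \<Longrightarrow> u \<in> U \<Longrightarrow> a e u \<in> carrier R"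
  shows "\<exists>x \<in> U \<rightarrow> carrier R. (\<exists>u\<in>U. x u \<noteq> \<zero>) \<and> (\<forall>e\<in>E. (\<Oplus>u\<in>U. a e u \<otimes> x u) = \<zero>)"
  using assms
proof (induction E arbitrary: U a rule: finite_induct)
  case empty
  then have "U \<noteq> {}" by auto
  then show ?case by (intro bexI[of _ "\<lambda>_. \<one>"]) auto
next
  case (insert e E)
  note ac = insert.prems(3)
  show ?case
  proof (cases "\<forall>u\<in>U. a e u = \<zero>")
    case True
    \<comment> \<open>Equation \<open>e\<close> is void here, so a solution of the other equations
      serves.\<close>
    have "\<exists>x \<in> U \<rightarrow> carrier R. (\<exists>u\<in>U. x u \<noteq> \<zero>) \<and> (\<forall>e\<in>E. (\<Oplus>u\<in>U. a e u \<otimes> x u) = \<zero>)"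
      using insert.prems insert.hyps by (intro insert.IH) auto
    then obtain x where x: "x \<in> U \<rightarrow> carrier R" "\<exists>u\<in>U. x u \<noteq> \<zero>"
      "\<forall>e\<in>E. (\<Oplus>u\<in>U. a e u \<otimes> x u) = \<zero>" by blast
    have "(\<Oplus>u\<in>U. a e u \<otimes> x u) = \<zero>"
      using x(1) True by (intro add.finprod_one_eqI) (auto dest: funcset_mem)
    with x show ?thesis by (intro bexI[of _ x]) auto
  next
    case False
    then obtain p where p: "p \<in> U" "a e p \<noteq> \<zero>" by blast
    define V where "V = U - {p}"
    have V: "finite V" "p \<notin> V" "U = insert p V" "V \<subseteq> U" using insert.prems(1) p(1) by (auto simp: V_def)
    \<comment> \<open>Equation \<open>e\<close> determines the unknown at the pivot \<open>p\<close>
      as minus the sum of the \<open>c u \<otimes> x u\<close>. Substituting this into equation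
      \<open>f\<close> leaves the coefficients \<open>a' f u\<close> on \<open>V\<close>.\<close>
    define c where "c u = inv (a e p) \<otimes> a e u" for u
    define a' where "a' f u = a f u \<ominus> a f p \<otimes> c u" for f u
    have inv: "inv (a e p) \<in> carrier R" "a e p \<otimes> inv (a e p) = \<one>"
      using p ac field_Units by auto
    have cc: "c u \<in> carrier R" if "u \<in> V" for u
      using that V inv ac by (auto simp: c_def)
    have a'c: "a' f u \<in> carrier R" if "f \<in> insert e E" "u \<in> V" for f u
      using that V p cc ac by (auto simp: a'_def)
    have "\<exists>x \<in> V \<rightarrow> carrier R. (\<exists>u\<in>V. x u \<noteq> \<zero>) \<and> (\<forall>f\<in>E. (\<Oplus>u\<in>V. a' f u \<otimes> x u) = \<zero>)"
      using insert.hyps insert.prems(2) V a'c by (intro insert.IH) auto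
    then obtain x where x: "x \<in> V \<rightarrow> carrier R" "\<exists>u\<in>V. x u \<noteq> \<zero>"
      and sol: "\<forall>f\<in>E. (\<Oplus>u\<in>V. a' f u \<otimes> x u) = \<zero>" by blast
    have xc: "x u \<in> carrier R" if "u \<in> V" for u using that x by auto
    define t where "t = (\<Oplus>u\<in>V. c u \<otimes> x u)"
    have tc: "t \<in> carrier R" unfolding t_def using cc xc by (intro finsum_closed) auto
    define y where "y = x(p := \<ominus> t)"
    \<comment> \<open>With the forced value of \<open>y\<close> at \<open>p\<close>, the
      contribution of \<open>p\<close> cancels the correction terms in \<open>a'\<close>.\<close>
    have sum: "(\<Oplus>u\<in>U. a f u \<otimes> y u) = (\<Oplus>u\<in>V. a' f u \<otimes> x u)" if f: "f \<in> insert e E" for f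
    proof -
      have afp: "a f p \<in> carrier R" using f p ac by auto
      have S: "(\<Oplus>u\<in>V. a' f u \<otimes> x u) \<in> carrier R" using a'c f xc by (intro finsum_closed) auto
      have "(\<Oplus>u\<in>V. a f u \<otimes> y u) = (\<Oplus>u\<in>V. a' f u \<otimes> x u \<oplus> a f p \<otimes> (c u \<otimes> x u))"
      proof (intro finsum_cong')
        fix u assume u: "u \<in> V"
        have "a f u = a' f u \<oplus> a f p \<otimes> c u"
          using u V f ac[of f u] afp cc[OF u] by (simp add: a'_def minus_eq a_assoc l_neg)
        moreover have "y u = x u" using u V(2) by (auto simp: y_def)
        ultimately show "a f u \<otimes> y u = a' f u \<otimes> x u \<oplus> a f p \<otimes> (c u \<otimes> x u)"
          using afp cc[OF u] a'c[OF f u] xc[OF u] by (simp add: l_distr m_assoc)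
      qed (use afp cc a'c f xc in auto)
      also have "\<dots> = (\<Oplus>u\<in>V. a' f u \<otimes> x u) \<oplus> (\<Oplus>u\<in>V. a f p \<otimes> (c u \<otimes> x u))"
        using afp cc a'c f xc by (intro finsum_addf) auto
      also have "(\<Oplus>u\<in>V. a f p \<otimes> (c u \<otimes> x u)) = a f p \<otimes> t"
        unfolding t_def using V afp cc xc by (intro finsum_rdistr[symmetric]) auto
      finally have *: "(\<Oplus>u\<in>V. a f u \<otimes> y u) = (\<Oplus>u\<in>V. a' f u \<otimes> x u) \<oplus> a f p \<otimes> t" .
      have "(\<Oplus>u\<in>U. a f u \<otimes> y u) = a f p \<otimes> y p \<oplus> (\<Oplus>u\<in>V. a f u \<otimes> y u)"
        unfolding V(3) using V f ac xc tc afp by (intro finsum_insert) (auto simp: y_def)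
      also have "\<dots> = (\<Oplus>u\<in>V. a' f u \<otimes> x u)"
        unfolding * using afp tc S a_lcomm[of "\<ominus> (a f p \<otimes> t)" "\<Oplus>u\<in>V. a' f u \<otimes> x u" "a f p \<otimes> t"]
        by (simp add: y_def r_minus l_neg)
      finally show ?thesis .
    qed
    \<comment> \<open>Row \<open>e\<close> of the reduced system vanishes identically, so equation
      \<open>e\<close> holds whatever \<open>x\<close> is.\<close>
    have "(\<Oplus>u\<in>V. a' e u \<otimes> x u) = \<zero>"
    proof (intro add.finprod_one_eqI)
      fix u assume u: "u \<in> V"
      have "a e p \<otimes> c u = a e u"
        using u V p ac inv by (simp add: c_def m_assoc[symmetric])
      then have "a' e u = \<zero>" using u V ac by (simp add: a'_def r_neg minus_eq)
      then show "a' e u \<otimes> x u = \<zero>" using xc[OF u] by simp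
    qed
    with sum sol have "\<forall>f\<in>insert e E. (\<Oplus>u\<in>U. a f u \<otimes> y u) = \<zero>" by auto
    moreover have "y \<in> U \<rightarrow> carrier R" using x(1) tc V by (auto simp: y_def)
    moreover have "\<exists>u\<in>U. y u \<noteq> \<zero>" using x(2) V by (auto simp: y_def)
    ultimately show ?thesis by blast
  qed
qed

text \<open>Comparing coordinates in a finite basis turns each vector equation into
  \<open>dim\<close> scalar ones. This gives \<open>card E * dim\<close> homogeneous equations in
  \<open>card U\<close> unknowns.\<close>

lemma (in vectorspace) simultaneous_linear_relation:
  assumes fd: "fin_dim" and E: "finite E" and U: "finite U" and card: "card E * dim < card U"
    and v: "\<And>e u. e \<in> E \<Longrightarrow> u \<in> U \<Longrightarrow> v e u \<in> carrier V"
  shows "\<exists>x \<in> U \<rightarrow> carrier K. (\<exists>u\<in>U. x u \<noteq> \<zero>\<^bsub>K\<^esub>) \<and>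
    (\<forall>e\<in>E. (\<Oplus>\<^bsub>V\<^esub>u\<in>U. x u \<odot>\<^bsub>V\<^esub> v e u) = \<zero>\<^bsub>V\<^esub>)"
proof -
  obtain B where B: "finite B" "basis B" using finite_basis_exists[OF fd] by blast
  have BV: "B \<subseteq> carrier V" and spanB: "span B = carrier V" using B(2) by (auto simp: basis_def)
  have "\<exists>a. a \<in> B \<rightarrow> carrier K \<and> w = lincomb a B" if "w \<in> carrier V" for w
    using that finite_span[OF B(1) BV] spanB by auto
  then obtain \<alpha> where \<alpha>: "\<And>w. w \<in> carrier V \<Longrightarrow> \<alpha> w \<in> B \<rightarrow> carrier K \<and> w = lincomb (\<alpha> w) B"
    by metis
  have \<alpha>c: "\<alpha> (v e u) b \<in> carrier K" if "e \<in> E" "u \<in> U" "b \<in> B" for e u b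
    using that \<alpha> v by blast
  have "card (E \<times> B) < card U" using card dim_basis[OF B] by (simp add: card_cartesian_product)
  then have "\<exists>x \<in> U \<rightarrow> carrier K. (\<exists>u\<in>U. x u \<noteq> \<zero>\<^bsub>K\<^esub>) \<and>
    (\<forall>p\<in>E \<times> B. (\<Oplus>\<^bsub>K\<^esub>u\<in>U. \<alpha> (v (fst p) u) (snd p) \<otimes>\<^bsub>K\<^esub> x u) = \<zero>\<^bsub>K\<^esub>)"
    using E B(1) U \<alpha>c by (intro homogeneous_system_nontrivial_solution) auto
  then obtain x where x: "x \<in> U \<rightarrow> carrier K" "\<exists>u\<in>U. x u \<noteq> \<zero>\<^bsub>K\<^esub>"
    and sol: "\<And>p. p \<in> E \<times> B \<Longrightarrow>
      (\<Oplus>\<^bsub>K\<^esub>u\<in>U. \<alpha> (v (fst p) u) (snd p) \<otimes>\<^bsub>K\<^esub> x u) = \<zero>\<^bsub>K\<^esub>"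
    by blast
  have xc: "x u \<in> carrier K" if "u \<in> U" for u using that x(1) by auto
  have "(\<Oplus>\<^bsub>V\<^esub>u\<in>U. x u \<odot>\<^bsub>V\<^esub> v e u) = \<zero>\<^bsub>V\<^esub>" if e: "e \<in> E" for e
  proof -
    have Bc: "b \<in> carrier V" if "b \<in> B" for b using that BV by auto
    have "(\<Oplus>\<^bsub>V\<^esub>u\<in>U. x u \<odot>\<^bsub>V\<^esub> v e u) = (\<Oplus>\<^bsub>V\<^esub>u\<in>U. \<Oplus>\<^bsub>V\<^esub>b\<in>B. (\<alpha> (v e u) b \<otimes>\<^bsub>K\<^esub> x u) \<odot>\<^bsub>V\<^esub> b)"
    proof (intro M.finsum_cong')
      fix u assume u: "u \<in> U"
      have "x u \<odot>\<^bsub>V\<^esub> v e u = x u \<odot>\<^bsub>V\<^esub> (\<Oplus>\<^bsub>V\<^esub>b\<in>B. \<alpha> (v e u) b \<odot>\<^bsub>V\<^esub> b)"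
        using \<alpha>[OF v[OF e u]] by (simp add: lincomb_def)
      also have "\<dots> = (\<Oplus>\<^bsub>V\<^esub>b\<in>B. x u \<odot>\<^bsub>V\<^esub> (\<alpha> (v e u) b \<odot>\<^bsub>V\<^esub> b))"
        using xc[OF u] \<alpha>c[OF e u] Bc by (intro finsum_smult) auto
      also have "\<dots> = (\<Oplus>\<^bsub>V\<^esub>b\<in>B. (\<alpha> (v e u) b \<otimes>\<^bsub>K\<^esub> x u) \<odot>\<^bsub>V\<^esub> b)"
        using xc[OF u] \<alpha>c[OF e u] Bc by (intro M.finsum_cong') (auto simp: smult_assoc1 m_comm)
      finally show "x u \<odot>\<^bsub>V\<^esub> v e u = (\<Oplus>\<^bsub>V\<^esub>b\<in>B. (\<alpha> (v e u) b \<otimes>\<^bsub>K\<^esub> x u) \<odot>\<^bsub>V\<^esub> b)" .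
    qed (use xc \<alpha>c e Bc in \<open>auto intro!: M.finsum_closed\<close>)
    \<comment> \<open>Exchanging the sums collects the coefficient of each basis vector
      \<open>b\<close>, which is the left side of equation \<open>(e, b)\<close> of the scalar
      system.\<close>
    also have "\<dots> = (\<Oplus>\<^bsub>V\<^esub>b\<in>B. \<Oplus>\<^bsub>V\<^esub>u\<in>U. (\<alpha> (v e u) b \<otimes>\<^bsub>K\<^esub> x u) \<odot>\<^bsub>V\<^esub> b)"
      using U B(1) xc \<alpha>c e Bc by (intro M.add.finprod_finprod_swap) auto
    also have "\<dots> = (\<Oplus>\<^bsub>V\<^esub>b\<in>B. (\<Oplus>\<^bsub>K\<^esub>u\<in>U. \<alpha> (v e u) b \<otimes>\<^bsub>K\<^esub> x u) \<odot>\<^bsub>V\<^esub> b)"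
      using xc \<alpha>c e Bc
      by (intro M.finsum_cong' finsum_smult_r[symmetric]) (auto intro!: M.finsum_closed)
    also have "\<dots> = \<zero>\<^bsub>V\<^esub>"
    proof (intro M.add.finprod_one_eqI)
      fix b assume b: "b \<in> B"
      show "(\<Oplus>\<^bsub>K\<^esub>u\<in>U. \<alpha> (v e u) b \<otimes>\<^bsub>K\<^esub> x u) \<odot>\<^bsub>V\<^esub> b = \<zero>\<^bsub>V\<^esub>"
        using sol[of "(e, b)"] e b Bc[OF b] by simp
    qed
    finally show ?thesis .
  qed
  with x show ?thesis by blast
qed

section \<open>Independent sets in possibly infinite dimension\<close>

text \<open>Greedy construction: no finite set spans, so a finite independent set can always be
  enlarged by a vector outside its span. A relation in the union of the stages involves finitely
  many vectors and hence lives in one stage.\<close>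

lemma (in vectorspace) infinite_independent_sequence:
  assumes "\<not> fin_dim"
  obtains b :: "nat \<Rightarrow> 'c" where "inj b" "range b \<subseteq> carrier V" "lin_indpt (range b)"
proof -
  have new: "\<exists>v\<in>carrier V. v \<notin> span S" if "finite S" "S \<subseteq> carrier V" for S
  proof (rule ccontr)
    assume "\<not> ?thesis"
    then have "span S = carrier V" using span_closed[OF that(2)] by auto
    then show False using assms that unfolding fin_dim_def by blast
  qed
  define h where "h S = (SOME v. v \<in> carrier V \<and> v \<notin> span S)" for S
  have h: "h S \<in> carrier V \<and> h S \<notin> span S" if "finite S" "S \<subseteq> carrier V" for S
    using someI_ex[of "\<lambda>v. v \<in> carrier V \<and> v \<notin> span S"] new[OF that] unfolding h_def by blast
  define A where "A = rec_nat {} (\<lambda>_ S. insert (h S) S)"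
  have A0: "A 0 = {}" and ASuc: "\<And>n. A (Suc n) = insert (h (A n)) (A n)" by (simp_all add: A_def)
  have A: "finite (A n) \<and> A n \<subseteq> carrier V \<and> lin_indpt (A n) \<and> card (A n) = n" for n
  proof (induction n)
    case 0
    show ?case by (simp add: A0 lin_dep_def)
  next
    case (Suc n)
    then have hn: "h (A n) \<in> carrier V" "h (A n) \<notin> span (A n)" using h by auto
    then have "h (A n) \<notin> A n" using Suc span_mem by blast
    then show ?case using Suc hn lin_dep_iff_in_span[of "A n" "h (A n)"] by (simp add: ASuc)
  qed
  have mono: "mono A" unfolding mono_iff_le_Suc using ASuc by auto
  let ?B = "\<Union>n. A n"
  have sub: "\<exists>n. F \<subseteq> A n" if "finite F" "F \<subseteq> ?B" for F
    using that
  proof (induction F)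
    case (insert x F)
    then obtain m n where "F \<subseteq> A n" "x \<in> A m" by auto
    then have "insert x F \<subseteq> A (max m n)"
      using monoD[OF mono, of m "max m n"] monoD[OF mono, of n "max m n"] by auto
    then show ?case by blast
  qed auto
  have li: "lin_indpt ?B"
  proof
    assume "lin_dep ?B"
    then obtain F a v where F: "finite F" "F \<subseteq> ?B" "a \<in> F \<rightarrow> carrier K" "lincomb a F = \<zero>\<^bsub>V\<^esub>"
      "v \<in> F" "a v \<noteq> \<zero>\<^bsub>K\<^esub>" unfolding lin_dep_def by blast
    obtain n where "F \<subseteq> A n" using sub[OF F(1,2)] ..
    then have "lin_dep (A n)"
      unfolding lin_dep_def using F(1,3-6) by (intro exI[of _ F] exI[of _ a] exI[of _ v] conjI)
    then show False using A by blast
  qed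
  \<comment> \<open>Stage \<open>n\<close> has exactly \<open>n\<close> elements, so the union has
    no finite bound.\<close>
  have "infinite ?B"
  proof
    assume "finite ?B"
    moreover have "A (Suc (card ?B)) \<subseteq> ?B" by blast
    ultimately have "card (A (Suc (card ?B))) \<le> card ?B" by (intro card_mono)
    then show False using A by simp
  qed
  then obtain b :: "nat \<Rightarrow> 'c" where b: "inj b" "range b \<subseteq> ?B"
    using infinite_countable_subset by blast
  show ?thesis
  proof (rule that[OF b(1)])
    show "range b \<subseteq> carrier V" using b(2) A by fast
    show "lin_indpt (range b)" using subset_li_is_li[OF li b(2)] .
  qed
qed

text \<open>In infinite dimension \<open>dim\<close> is an unspecified number (\<open>LEAST\<close> of an empty predicate),
  but independent sets of every finite size exist.\<close>

lemma (in vectorspace) independent_set_card_dim: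
  obtains A where "finite A" "A \<subseteq> carrier V" "lin_indpt A" "card A = dim"
proof (cases fin_dim)
  case True
  then obtain B where B: "finite B" "basis B" using finite_basis_exists by blast
  then show ?thesis using that[of B] dim_basis by (simp add: basis_def)
next
  case False
  then obtain b :: "nat \<Rightarrow> 'c" where b: "inj b" "range b \<subseteq> carrier V" "lin_indpt (range b)"
    by (rule infinite_independent_sequence)
  show ?thesis
  proof (rule that[of "b ` {..<dim}"])
    show "lin_indpt (b ` {..<dim})" by (rule subset_li_is_li[OF b(3)]) auto
    show "card (b ` {..<dim}) = dim" using b(1) by (simp add: card_image inj_on_subset)
  qed (use b in auto)
qed

section \<open>Finite sums and cosets in the residue and quotient modules\<close>

lemma (in cring) finsum_residue_module:
  assumes M: "abelian_monoid (residue_module R V)" and V: "V \<subseteq> carrier R" and f: "f \<in> A \<rightarrow> V"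
  shows "finsum (residue_module R V) f A = finsum R f A"
proof -
  interpret M: abelian_monoid "residue_module R V" by fact
  have [simp]: "carrier (residue_module R V) = V" "add (residue_module R V) = add R"
    "zero (residue_module R V) = \<zero>" by (simp_all add: residue_module_def)
  from f show ?thesis
  \<comment> \<open>Over an infinite index set both sums default to zero.\<close>
  proof (induction A rule: infinite_finite_induct)
    case (insert x F)
    then have "f \<in> F \<rightarrow> carrier R" "f x \<in> carrier R" using V by auto
    with insert show ?case by (simp add: Pi_iff)
  qed (use M.finsum_infinite M.finsum_empty in auto)
qed

lemma (in ring) finsum_quotient_module:
  assumes M: "abelian_monoid (quotient_module R J I)"
    and I: "ideal I R" and J: "ideal J R" and f: "f \<in> A \<rightarrow> J"
  shows "finsum (quotient_module R J I) (\<lambda>x. I +> f x) A = I +> finsum R f A"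
proof -
  interpret M: abelian_monoid "quotient_module R J I" by fact
  interpret I: ideal I R by fact
  interpret J: ideal J R by fact
  have [simp]: "carrier (quotient_module R J I) = (\<lambda>x. I +> x) ` J" "add (quotient_module R J I) = set_add R"
    "zero (quotient_module R J I) = I" by (simp_all add: quotient_module_def)
  have zero: "I = I +> \<zero>" using a_rcos_zero[OF I] I.zero_closed by simp
  from f show ?thesis
  proof (induction A rule: infinite_finite_induct)
    case (insert x F)
    then have "f \<in> F \<rightarrow> carrier R" "f x \<in> carrier R" using J.Icarr by (auto simp: Pi_iff)
    with insert show ?case by (simp add: Pi_iff I.a_rcos_sum)
  qed (use M.finsum_infinite M.finsum_empty zero in auto)
qed

lemma (in ideal) coset_eq_ideal_iff:
  assumes "x \<in> carrier R"
  shows "I +> x = I \<longleftrightarrow> x \<in> I"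
  using a_rcos_self[OF assms] a_rcos_const by metis

lemma (in ideal) carrier_FactRing_iff:
  "A \<in> carrier (R Quot I) \<longleftrightarrow> (\<exists>a\<in>carrier R. A = I +> a)"
  by (auto simp: FactRing_def A_RCOSETS_def' a_r_coset_def')

section \<open>Linear algebra over the residue field, carried back to the ring\<close>

text \<open>An element of \<open>R\<close> acts on \<open>V\<close> as its coset modulo
  \<open>\<mm>\<close> does, so closure under residue scalars is closure under multiplication by
  \<open>R\<close>. This makes chain conditions on ideals applicable to subspaces.\<close>

lemma (in local_ring) socle_subspace_ideal:
  assumes V: "V \<subseteq> colon R {\<zero>} \<mm>"
    and W: "subspace (R Quot \<mm>) W (residue_module R V)"
  shows "ideal W R"
proof -
  interpret W: submodule "R Quot \<mm>" W "residue_module R V" using W by (simp add: subspace_def)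
  have WV: "W \<subseteq> V" using W.subset by (simp add: residue_module_def)
  then have WR: "W \<subseteq> carrier R" using V by (auto simp: colon_def)
  have mult: "a \<otimes> x \<in> W" if a: "a \<in> carrier R" and x: "x \<in> W" for a x
  proof -
    have "\<mm> +> a \<in> carrier (R Quot \<mm>)" using a carrier_FactRing_iff by blast
    then have "(\<mm> +> a) \<odot>\<^bsub>residue_module R V\<^esub> x \<in> W" using x W.smult_closed by blast
    then show ?thesis using residue_smult[OF is_ideal V a] x WV by auto
  qed
  show ?thesis
  proof (rule idealI)
    show "ring R" by (rule ring_axioms)
    show "subgroup W (add_monoid R)"
    proof (rule add.subgroupI)
      show "W \<noteq> {}" using W.zero_closed by blast
      fix x assume x: "x \<in> W"
      then have "\<ominus> \<one> \<otimes> x \<in> W" using mult by simp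
      moreover have "\<ominus> \<one> \<otimes> x = \<ominus> x" using x WR l_minus[OF one_closed, of x] by auto
      ultimately show "\<ominus> x \<in> W" by simp
      fix y assume "y \<in> W"
      then show "x \<oplus> y \<in> W" using x W.m_closed by (simp add: residue_module_def)
    qed (use WR in auto)
    fix a x assume "a \<in> W" "x \<in> carrier R"
    then show "x \<otimes> a \<in> W" "a \<otimes> x \<in> W" using mult WR m_comm by fastforce+
  qed
qed

text \<open>Here the descending chain condition becomes a statement about dimension. Finiteness
  makes \<open>dim\<close> the true dimension and permits coordinates in a finite basis.\<close>

lemma (in local_ring) residue_module_fin_dim:
  assumes art: "artinian_ring R" and V: "ideal V R" "V \<subseteq> colon R {\<zero>} \<mm>"
  shows "vectorspace.fin_dim (R Quot \<mm>) (residue_module R V)"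
proof -
  interpret V: vectorspace "R Quot \<mm>" "residue_module R V" by (rule residue_module_vectorspace[OF V])
  show ?thesis
  proof (rule ccontr)
    assume "\<not> V.fin_dim"
    then obtain b :: "nat \<Rightarrow> 'a" where b: "inj b" "range b \<subseteq> carrier (residue_module R V)"
      "V.lin_indpt (range b)" by (rule V.infinite_independent_sequence)
    \<comment> \<open>The spans of the tails would form a strictly descending chain of ideals.\<close>
    define C where "C k = V.span (b ` {k..})" for k
    have tail: "b ` {k..} \<subseteq> carrier (residue_module R V)" for k using b(2) by auto
    have "ideal (C k) R" for k
      unfolding C_def by (rule socle_subspace_ideal[OF V(2) V.span_is_subspace[OF tail]])
    moreover have "C (Suc k) \<subseteq> C k" for k
      unfolding C_def by (rule V.span_is_monotone) auto
    ultimately have "\<exists>N. \<forall>k\<ge>N. C k = C N"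
      by (rule artinian_ring.descending_chain_condition[OF art])
    then obtain N where N: "\<forall>k\<ge>N. C k = C N" ..
    \<comment> \<open>Stability at \<open>N\<close> puts \<open>b N\<close> into the span of the
      later vectors, against independence.\<close>
    have "C (Suc N) = C N" using N[rule_format, of "Suc N"] by simp
    moreover have "b N \<in> C N" unfolding C_def using V.span_mem[OF tail] by auto
    ultimately have "b N \<in> V.span (b ` {Suc N..})" by (simp add: C_def)
    moreover have "V.lin_indpt (b ` {Suc N..})" "V.lin_indpt (b ` {Suc N..} \<union> {b N})"
      by (rule V.subset_li_is_li[OF b(3)]; auto)+
    moreover have "b N \<notin> b ` {Suc N..}" using b(1) by (auto dest: injD)
    ultimately show False
      using V.lin_dep_iff_in_span[OF tail, of "Suc N" "b N"] b(2) by auto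
  qed
qed

text \<open>A relation over the residue field is lifted by choosing representatives of its
  coefficients. Any choice works because \<open>\<mm>\<close> annihilates \<open>V\<close>, and a
  scalar is nonzero exactly when its representatives lie outside \<open>\<mm>\<close>.\<close>

lemma (in local_ring) socle_linear_relation:
  assumes art: "artinian_ring R" and V: "ideal V R" "V \<subseteq> colon R {\<zero>} \<mm>"
    and E: "finite E" and U: "finite U"
    and card: "card E * vectorspace.dim (R Quot \<mm>) (residue_module R V) < card U"
    and v: "\<And>e u. e \<in> E \<Longrightarrow> u \<in> U \<Longrightarrow> v e u \<in> V"
  shows "\<exists>x \<in> U \<rightarrow> carrier R. (\<exists>u\<in>U. x u \<notin> \<mm>) \<and> (\<forall>e\<in>E. (\<Oplus>u\<in>U. x u \<otimes> v e u) = \<zero>)"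
proof -
  interpret V: vectorspace "R Quot \<mm>" "residue_module R V" by (rule residue_module_vectorspace[OF V])
  have VR: "V \<subseteq> carrier R" using V(2) by (auto simp: colon_def)
  have [simp]: "carrier (residue_module R V) = V" "zero (residue_module R V) = \<zero>"
    by (simp_all add: residue_module_def)
  obtain X where X: "X \<in> U \<rightarrow> carrier (R Quot \<mm>)" "\<exists>u\<in>U. X u \<noteq> \<zero>\<^bsub>R Quot \<mm>\<^esub>"
    and sol: "\<forall>e\<in>E. (\<Oplus>\<^bsub>residue_module R V\<^esub>u\<in>U. X u \<odot>\<^bsub>residue_module R V\<^esub> v e u) = \<zero>"
    using V.simultaneous_linear_relation[OF residue_module_fin_dim[OF art V] E U card, of v] v by auto
  have "\<forall>u\<in>U. \<exists>a\<in>carrier R. X u = \<mm> +> a"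
    using funcset_mem[OF X(1)] carrier_FactRing_iff by blast
  then obtain x where x: "\<forall>u\<in>U. x u \<in> carrier R \<and> X u = \<mm> +> x u"
    using bchoice[of U "\<lambda>u a. a \<in> carrier R \<and> X u = \<mm> +> a"] by blast
  have "(\<Oplus>u\<in>U. x u \<otimes> v e u) = \<zero>" if e: "e \<in> E" for e
  proof -
    have "(\<Oplus>u\<in>U. x u \<otimes> v e u) = (\<Oplus>\<^bsub>residue_module R V\<^esub>u\<in>U. x u \<otimes> v e u)"
      using x v e ideal.I_l_closed[OF V(1)]
      by (intro finsum_residue_module[symmetric] V.M.abelian_monoid_axioms VR) auto
    also have "\<dots> = (\<Oplus>\<^bsub>residue_module R V\<^esub>u\<in>U. X u \<odot>\<^bsub>residue_module R V\<^esub> v e u)"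
      using x v e residue_smult[OF is_ideal V(2)] ideal.I_l_closed[OF V(1)]
      by (intro V.M.finsum_cong') auto
    finally show ?thesis using sol e by simp
  qed
  moreover have "\<exists>u\<in>U. x u \<notin> \<mm>"
    using X(2) x coset_eq_ideal_iff by (auto simp: FactRing_def)
  ultimately show ?thesis using x by (intro bexI[of _ x]) auto
qed

text \<open>\<open>B\<close> represents an independent subset of \<open>J / I\<close>: zero
  coefficients over the residue field mean coefficients in \<open>\<mm>\<close> over
  \<open>R\<close>. An independent set of \<open>dim\<close> elements replaces a basis, so that
  infinite dimension is covered too.\<close>

lemma (in local_ring) quotient_module_independent_representatives:
  assumes I: "ideal I R" and J: "ideal J R" "J \<subseteq> colon R I \<mm>"
  shows "\<exists>B. finite B \<and> B \<subseteq> J \<and>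
    card B = vectorspace.dim (R Quot \<mm>) (quotient_module R J I) \<and>
    (\<forall>x \<in> B \<rightarrow> carrier R. (\<Oplus>b\<in>B. x b \<otimes> b) \<in> I \<longrightarrow> x \<in> B \<rightarrow> \<mm>)"
proof -
  interpret V: vectorspace "R Quot \<mm>" "quotient_module R J I"
    by (rule quotient_module_vectorspace[OF I J])
  interpret I: ideal I R by fact
  interpret J: ideal J R by fact
  have [simp]: "carrier (quotient_module R J I) = (\<lambda>x. I +> x) ` J" "zero (quotient_module R J I) = I"
    by (simp_all add: quotient_module_def)
  obtain A where A: "finite A" "A \<subseteq> carrier (quotient_module R J I)" "V.lin_indpt A" "card A = V.dim"
    by (rule V.independent_set_card_dim)
  have "\<forall>c\<in>A. \<exists>b\<in>J. c = I +> b" using A(2) by auto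
  then obtain \<rho> where \<rho>: "\<And>c. c \<in> A \<Longrightarrow> \<rho> c \<in> J" "\<And>c. c \<in> A \<Longrightarrow> I +> \<rho> c = c" by metis
  \<comment> \<open>The coset map is a left inverse of \<open>\<rho>\<close>, so cardinality is kept
    and sums can be reindexed.\<close>
  have inj: "inj_on \<rho> A" using \<rho>(2) by (metis inj_onI)
  show ?thesis
  proof (intro exI[of _ "\<rho> ` A"] conjI ballI impI Pi_I)
    show "card (\<rho> ` A) = V.dim" using A(4) card_image[OF inj] by simp
    fix x b assume x: "x \<in> \<rho> ` A \<rightarrow> carrier R" and sum: "(\<Oplus>b\<in>\<rho> ` A. x b \<otimes> b) \<in> I"
      and b: "b \<in> \<rho> ` A"
    have xc: "x (\<rho> c) \<in> carrier R" if "c \<in> A" for c using that x by auto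
    let ?a = "\<lambda>c. \<mm> +> x (\<rho> c)"
    have ac: "?a \<in> A \<rightarrow> carrier (R Quot \<mm>)"
      using xc carrier_FactRing_iff by blast
    have act: "?a c \<odot>\<^bsub>quotient_module R J I\<^esub> c = I +> (x (\<rho> c) \<otimes> \<rho> c)" if "c \<in> A" for c
      using quotient_smult[OF is_ideal I J(2) xc[OF that] \<rho>(1)[OF that]] \<rho>(2)[OF that] by simp
    have "V.lincomb ?a A = (\<Oplus>\<^bsub>quotient_module R J I\<^esub>c\<in>A. I +> (x (\<rho> c) \<otimes> \<rho> c))"
      unfolding V.lincomb_def using act xc \<rho>(1) J.I_l_closed
      by (intro V.M.finsum_cong') auto
    also have "\<dots> = I +> (\<Oplus>c\<in>A. x (\<rho> c) \<otimes> \<rho> c)"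
      using xc \<rho>(1) J.I_l_closed
      by (intro finsum_quotient_module V.M.abelian_monoid_axioms I J) auto
    also have "(\<Oplus>c\<in>A. x (\<rho> c) \<otimes> \<rho> c) = (\<Oplus>b\<in>\<rho> ` A. x b \<otimes> b)"
      using xc \<rho>(1) J.Icarr by (intro add.finprod_reindex[symmetric] inj) auto
    also have "I +> \<dots> = I" using sum I.coset_eq_ideal_iff I.Icarr by simp
    finally have "V.lincomb ?a A = \<zero>\<^bsub>quotient_module R J I\<^esub>" by simp
    then have "?a c = \<zero>\<^bsub>R Quot \<mm>\<^esub>" if "c \<in> A" for c
      using that A(1,3) ac unfolding V.lin_dep_def by blast
    then show "x b \<in> \<mm>" using b xc coset_eq_ideal_iff by (auto simp: FactRing_def)
  qed (use A(1) \<rho>(1) in auto)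
qed

section \<open>Polynomials annihilating \<open>g\<close>\<close>

lemma (in UP_ring) coeff_monom_one_mult:
  assumes p: "p \<in> carrier P"
  shows "coeff P (monom P \<one> k \<otimes>\<^bsub>P\<^esub> p) j = (if j < k then \<zero> else coeff P p (j - k))"
proof -
  have "coeff P (monom P \<one> k \<otimes>\<^bsub>P\<^esub> p) j = (\<Oplus>i\<in>{..j}. if k = i then coeff P p (j - i) else \<zero>)"
    using p by (auto intro!: R.finsum_cong')
  \<comment> \<open>Only \<open>i = k\<close> contributes, and this index occurs only if
    \<open>k \<le> j\<close>.\<close>
  also have "\<dots> = (if j < k then \<zero> else coeff P p (j - k))"
    using p R.finsum_singleton[of k "{..j}" "\<lambda>i. coeff P p (j - i)"]
    by (auto intro!: R.add.finprod_one_eqI)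
  finally show ?thesis .
qed

theorem theorem3p1:
  fixes R :: "('a, 'b) ring_scheme" (structure)
    and \<mm> I J :: "'a set"
    and g :: "nat \<Rightarrow> 'a"
    and n m r s :: nat
  assumes "local_ring \<mm> R" and "artinian_ring R"
    and "s = vectorspace.dim (R Quot \<mm>) (residue_module R (colon R {\<zero>} \<mm>))"
    and "g \<in> carrier (UP R)" and "deg R g = n"
    and "I = colon R {\<zero>} (content R g)"
    and "ideal J R" and "I \<subseteq> J" and "J \<subseteq> colon R I \<mm>"
    and "r = vectorspace.dim (R Quot \<mm>) (quotient_module R J I)" and "r > s"
    and "(m + 1) * r > (n + m + 1) * s"
  shows "\<exists>f \<in> carrier (UP R). deg R f = m \<and>
    content R f \<subseteq> J \<and>
    f \<otimes>\<^bsub>UP R\<^esub> g = \<zero>\<^bsub>UP R\<^esub> \<and>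
    content R f \<cdot> content R g \<noteq> {\<zero>}"
proof -
  interpret local_ring \<mm> R by fact
  interpret UP: UP_cring R "UP R" by unfold_locales auto
  interpret J: ideal J R by fact
  let ?S = "colon R {\<zero>} \<mm>"
  have mR: "\<mm> \<subseteq> carrier R" using Icarr by blast
  have S: "ideal ?S R" "?S \<subseteq> ?S" using colon_ideal[OF zeroideal mR] by auto
  have gc: "coeff (UP R) g i \<in> carrier R" for i using assms(4) by simp
  have cg: "ideal (content R g) R" unfolding content_def using gc by (intro genideal_ideal) auto
  interpret cg: ideal "content R g" R by (rule cg)
  have g_content: "coeff (UP R) g i \<in> content R g" for i
    unfolding content_def using gc genideal_self[of "range (coeff (UP R) g)"] by auto
  have I: "ideal I R" unfolding assms(6) using cg.Icarr by (intro colon_ideal zeroideal) auto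
  obtain B where B: "finite B" "B \<subseteq> J" "card B = r"
    and indep: "\<forall>x \<in> B \<rightarrow> carrier R. (\<Oplus>b\<in>B. x b \<otimes> b) \<in> I \<longrightarrow> x \<in> B \<rightarrow> \<mm>"
    using quotient_module_independent_representatives[OF I assms(7,9)] unfolding assms(10) by blast
  have Bc: "b \<in> carrier R" if "b \<in> B" for b using that B(2) J.Icarr by blast
  have socle: "b \<otimes> k \<in> ?S" if b: "b \<in> J" and k: "k \<in> content R g" for b k
  proof -
    have "b \<otimes> k \<otimes> a = \<zero>" if a: "a \<in> \<mm>" for a
    proof -
      have "b \<otimes> a \<in> I" using assms(9) a b by (auto simp: colon_def)
      then have "(b \<otimes> a) \<otimes> k = \<zero>" using k by (auto simp: assms(6) colon_def)
      then show ?thesis using a b k Icarr J.Icarr cg.Icarr by (simp add: m_ac)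
    qed
    then show ?thesis using b k J.Icarr cg.Icarr by (simp add: colon_def)
  qed
  \<comment> \<open>\<open>G d i\<close> is the factor of the coefficient \<open>i\<close> of \<open>f\<close> in the coefficient \<open>d\<close> of \<open>f g\<close>.\<close>
  define G where "G d i = (if i \<le> d then coeff (UP R) g (d - i) else \<zero>)" for d i
  have G: "G d i \<in> content R g" for d i using g_content cg.zero_closed by (auto simp: G_def)
  have Gc: "G d i \<in> carrier R" for d i using G cg.Icarr by blast
  \<comment> \<open>The degrees from \<open>0\<close> to \<open>n + m\<close> give
    \<open>n + m + 1\<close> equations in the socle, against \<open>(m + 1) * r\<close> unknowns.
    The unknown \<open>x (i, b)\<close> is the coefficient of \<open>b\<close> in the coefficient
    \<open>F i\<close> built below.\<close>
  have "card {..n + m} * vectorspace.dim (R Quot \<mm>) (residue_module R ?S) < card ({..m} \<times> B)"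
    using assms(12) B(3) by (simp add: assms(3)[symmetric] card_cartesian_product)
  then have "\<exists>x \<in> {..m} \<times> B \<rightarrow> carrier R. (\<exists>u\<in>{..m} \<times> B. x u \<notin> \<mm>) \<and>
    (\<forall>d\<in>{..n + m}. (\<Oplus>u\<in>{..m} \<times> B. x u \<otimes> (snd u \<otimes> G d (fst u))) = \<zero>)"
    using B(1,2) G socle by (intro socle_linear_relation[OF assms(2) S]) auto
  then obtain x where x: "x \<in> {..m} \<times> B \<rightarrow> carrier R" "\<exists>u\<in>{..m} \<times> B. x u \<notin> \<mm>"
    and sol: "\<forall>d\<in>{..n + m}. (\<Oplus>u\<in>{..m} \<times> B. x u \<otimes> (snd u \<otimes> G d (fst u))) = \<zero>"
    by blast
  have xc: "x (i, b) \<in> carrier R" if "i \<le> m" "b \<in> B" for i b using that x(1) by auto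
  define F where "F i = (if i \<le> m then \<Oplus>b\<in>B. x (i, b) \<otimes> b else \<zero>)" for i
  have FJ: "F i \<in> J" for i
  proof (cases "i \<le> m")
    case True
    have "(\<Oplus>b\<in>A. x (i, b) \<otimes> b) \<in> J" if "A \<subseteq> B" for A
      using finite_subset[OF that B(1)] that
    proof (induction A)
      case (insert b A)
      have "(\<Oplus>b\<in>insert b A. x (i, b) \<otimes> b) = x (i, b) \<otimes> b \<oplus> (\<Oplus>b\<in>A. x (i, b) \<otimes> b)"
        using insert xc[OF True] Bc by (intro finsum_insert) auto
      then show ?case using insert xc[OF True] B(2) J.I_l_closed by (auto intro!: J.a_closed)
    qed (simp add: J.zero_closed)
    then show ?thesis using True by (simp add: F_def)
  qed (simp add: F_def J.zero_closed)
  \<comment> \<open>If \<open>F i\<close> were in \<open>I\<close>, independence would force every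
    \<open>x (i, b)\<close> into \<open>\<mm>\<close>. An unknown outside \<open>\<mm>\<close> thus
    yields a coefficient outside \<open>I\<close>.\<close>
  obtain i0 where i0: "F i0 \<notin> I"
  proof -
    obtain i b where u: "i \<le> m" "b \<in> B" "x (i, b) \<notin> \<mm>" using x(2) by auto
    moreover from u have "(\<lambda>b. x (i, b)) \<in> B \<rightarrow> carrier R" using xc by auto
    ultimately have "F i \<notin> I" using bspec[OF indep] by (auto simp: F_def)
    then show thesis by (rule that)
  qed
  have Fc: "F i \<in> carrier R" for i using FJ J.Icarr by blast
  have F_up: "F \<in> up R" using Fc by (auto simp: F_def intro!: exI[of _ m] mem_upI)
  then have F: "F \<in> carrier (UP R)" and coeff_F: "coeff (UP R) F = F" by (simp_all add: UP_def)
  have Fg: "F \<otimes>\<^bsub>UP R\<^esub> g = \<zero>\<^bsub>UP R\<^esub>"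
  proof (rule UP.up_eqI)
    fix d
    show "coeff (UP R) (F \<otimes>\<^bsub>UP R\<^esub> g) d = coeff (UP R) \<zero>\<^bsub>UP R\<^esub> d"
    proof (cases "d \<le> n + m")
      case True
      have "coeff (UP R) (F \<otimes>\<^bsub>UP R\<^esub> g) d = (\<Oplus>i\<in>{..d}. F i \<otimes> G d i)"
        using F assms(4) Fc gc by (auto simp: coeff_F G_def intro!: finsum_cong')
      \<comment> \<open>The ranges \<open>{..d}\<close> and \<open>{..m}\<close> are compared
        through \<open>{..d + m}\<close>, which contains both: \<open>G d i\<close> vanishes for
        \<open>i > d\<close> and \<open>F i\<close> for \<open>i > m\<close>.\<close>
      also have "\<dots> = (\<Oplus>i\<in>{..d + m}. F i \<otimes> G d i)"
        using Fc Gc by (intro add.finprod_mono_neutral_cong_left) (auto simp: G_def)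
      also have "\<dots> = (\<Oplus>i\<in>{..m}. F i \<otimes> G d i)"
        using Fc Gc by (intro add.finprod_mono_neutral_cong_right) (auto simp: F_def)
      also have "\<dots> = (\<Oplus>i\<in>{..m}. \<Oplus>b\<in>B. x (i, b) \<otimes> (b \<otimes> G d i))"
      proof (intro finsum_cong')
        fix i assume "i \<in> {..m}"
        then have i: "i \<le> m" by simp
        have "F i \<otimes> G d i = (\<Oplus>b\<in>B. (x (i, b) \<otimes> b) \<otimes> G d i)"
          unfolding F_def using i B(1) xc[OF i] Bc Gc by (simp add: finsum_ldistr Pi_iff)
        also have "\<dots> = (\<Oplus>b\<in>B. x (i, b) \<otimes> (b \<otimes> G d i))"
          using xc[OF i] Bc Gc by (intro finsum_cong') (auto simp: m_assoc)
        finally show "F i \<otimes> G d i = (\<Oplus>b\<in>B. x (i, b) \<otimes> (b \<otimes> G d i))" .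
      qed (use xc Bc Gc in \<open>auto intro!: finsum_closed\<close>)
      also have "\<dots> = finsum R (\<lambda>(i, b). x (i, b) \<otimes> (b \<otimes> G d i)) ({..m} \<times> B)"
        using B(1) xc Bc Gc by (intro add.finprod_finprod) auto
      also have "\<dots> = \<zero>" using sol True by (simp add: case_prod_unfold)
      finally show ?thesis by simp
    next
      case False
      \<comment> \<open>These degrees impose no equation on \<open>x\<close>: for
        \<open>i \<le> m\<close> the index \<open>d - i\<close> exceeds the degree \<open>n\<close>
        of \<open>g\<close>, and for larger \<open>i\<close> the coefficient \<open>F i\<close> is
        zero.\<close>
      have "F i \<otimes> coeff (UP R) g (d - i) = \<zero>" for i
      proof (cases "i \<le> m")
        case True
        then have "coeff (UP R) g (d - i) = \<zero>"
          using False assms(5) UP.deg_aboveD[of g "d - i"] assms(4) by simp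
        then show ?thesis using Fc by simp
      qed (use gc in \<open>simp add: F_def\<close>)
      then show ?thesis using F assms(4) by (simp add: coeff_F)
    qed
  qed (use F assms(4) in auto)
  define k where "k = deg R F"
  have "k \<le> m" unfolding k_def using F by (intro UP.deg_aboveI) (auto simp: coeff_F F_def)
  \<comment> \<open>The zero polynomial has all its coefficients in \<open>I\<close>, unlike
    \<open>F\<close>.\<close>
  have "F \<noteq> \<zero>\<^bsub>UP R\<^esub>"
  proof
    assume "F = \<zero>\<^bsub>UP R\<^esub>"
    then have "F i0 = \<zero>" using coeff_F UP.coeff_zero by metis
    then show False using i0 ideal.axioms(1)[OF I] additive_subgroup.zero_closed by metis
  qed
  then have Fk: "F k \<noteq> \<zero>" using UP.lcoeff_nonzero[OF _ F] by (simp add: coeff_F k_def)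
  \<comment> \<open>The kernel element may have degree below \<open>m\<close>; multiplying by a power of the
    indeterminate corrects this and keeps the content.\<close>
  define f where "f = monom (UP R) \<one> (m - k) \<otimes>\<^bsub>UP R\<^esub> F"
  have f: "f \<in> carrier (UP R)" using F by (simp add: f_def)
  have coeff_f: "coeff (UP R) f j = (if j < m - k then \<zero> else F (j - (m - k)))" for j
    unfolding f_def using UP.coeff_monom_one_mult[OF F] by (simp add: coeff_F)
  have fc: "range (coeff (UP R) f) \<subseteq> carrier R" using f by auto
  \<comment> \<open>Coefficient \<open>m\<close> of \<open>f\<close> is \<open>F k\<close>, and
    indices above \<open>m\<close> shift back to indices above the degree of
    \<open>F\<close>.\<close>
  have "deg R f = m"
  proof (intro le_antisym UP.deg_aboveI UP.deg_belowI)
    fix j assume "m < j"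
    then have "deg R F < j - (m - k)" using \<open>k \<le> m\<close> by (simp add: k_def)
    then show "coeff (UP R) f j = \<zero>" using UP.deg_aboveD[OF _ F] by (simp add: coeff_f coeff_F)
  qed (use Fk \<open>k \<le> m\<close> f in \<open>auto simp: coeff_f\<close>)
  moreover have "content R f \<subseteq> J"
    unfolding content_def using FJ J.zero_closed by (intro genideal_minimal assms(7)) (auto simp: coeff_f)
  moreover have "f \<otimes>\<^bsub>UP R\<^esub> g = \<zero>\<^bsub>UP R\<^esub>"
    unfolding f_def using F Fg assms(4) by (simp add: UP.P.m_assoc)
  moreover have "content R f \<cdot> content R g \<noteq> {\<zero>}"
  proof
    assume zero: "content R f \<cdot> content R g = {\<zero>}"
    \<comment> \<open>The shift keeps \<open>F i0\<close> as a coefficient. A zero product of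
      contents would make it annihilate \<open>content R g\<close>, that is, lie in
      \<open>I\<close>.\<close>
    have "F i0 = coeff (UP R) f (i0 + (m - k))" by (simp add: coeff_f)
    then have "F i0 \<in> content R f"
      unfolding content_def using genideal_self[OF fc] by auto
    then have "F i0 \<otimes> y = \<zero>" if "y \<in> content R g" for y
      using zero ideal_prod.prod[of "F i0" "content R f" y "content R g" R] that by auto
    then show False using i0 Fc by (simp add: assms(6) colon_def)
  qed
  ultimately show ?thesis using f by blast
qed

end
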